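(* Let $P^{\ast}(\boldsymbol z)=\sum_{\boldsymbol i\in\mathcal{X}_{d-1}}a_{\boldsymbol i}\boldsymbol z^{\boldsymbol i}\in\mathcal{I}_{\mathcal{P}}\subseteq\mathbb{Q}[z_1,\dots,z_{d-1}]$ be a non-null polynomial that verifies the following three properties: (1) $a_{\boldsymbol i}=0$ for every $\boldsymbol i\notin\mathscr{I}^{\ast}_{d-1}$; (2) the sum of the coefficients of the monomials of the same order is equal to $0$, i.e. for every integer $k$, $\sum_{\boldsymbol i:\ i_1+\dots+i_{d-1}=k}a_{\boldsymbol i}=0$; (3) the sum of the coefficients of the monomials containing $z_j$ is equal to $0$, i.e. $\sum_{\boldsymbol i:\ i_j=1}a_{\boldsymbol i}=0$, for every $j\in\{1,\dots,d-1\}$. Then the type-0 pmf $f^{\ast}$ corresponding to $P^{\ast}(\boldsymbol z)$ is a $\Sigma_{cx}$-smallest pmf of $\mathcal{SB}_d$, and the set $$\big\{f: f=\lambda f^{\ast}+(1-\lambda)f^{K\ast},\ \lambda\in(0,1]\big\},$$ where $f^{K\ast}$ is a (i.e. ranges over the) $\Sigma_{cx}$-smallest pmf of $\mathcal{SB}_d$ with null polynomial, $\mathcal{H}(f^{K\ast})=0$, is the set of all $\Sigma_{cx}$-smallest pmfs of $\mathcal{SB}_d$ corresponding (via $\mathcal{H}$) to polynomials equivalent to $P^{\ast}(\boldsymbol z)$.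
   Context: $d\ge2$ is an integer, $\mathcal{X}_n=\{0,1\}^n$, and $\boldsymbol 1_n$ is the all-ones vector of length $n$. $\mathcal{SB}_d$ is the class of probability mass functions (pmfs) $f:\{0,1\}^d\to[0,1]$ of random vectors $\boldsymbol X=(X_1,\dots,X_d)$ whose one-dimensional marginals are all Bernoulli with mean $1/2$. Convex order: for random variables with finite means, $Y_1\le_{cx}Y_2$ if $E[\phi(Y_1)]\le E[\phi(Y_2)]$ for all real-valued convex functions $\phi$ for which the expectations are finite. A random vector $\boldsymbol X$ with pmf in $\mathcal{SB}_d$ (or its pmf) is $\Sigma_{cx}$-smallest in $\mathcal{SB}_d$ if $\sum_{j=1}^dX_j\le_{cx}\sum_{j=1}^dX'_j$ for every random vector $\boldsymbol X'$ with pmf in $\mathcal{SB}_d$. $\mathbb{Q}[\boldsymbol z]=\mathbb{Q}[z_1,\dots,z_{d-1}]$ is the ring of polynomials with rational coefficients in $\boldsymbol z=(z_1,\dots,z_{d-1})$. For $\boldsymbol i\in\mathcal{X}_{d-1}$ let $\boldsymbol s_{\boldsymbol i}=(i_1,\dots,i_{d-1},0)\in\mathcal{X}_d$ and $\boldsymbol z^{\boldsymbol i}=\prod_{j=1}^{d-1}z_j^{i_j}$. The linear map $\mathcal{H}:\mathcal{SB}_d\to\mathbb{Q}[z_1,\dots,z_{d-1}]$ is $\mathcal{H}(f)=\sum_{\boldsymbol i\in\mathcal{X}_{d-1}}\big(f(\boldsymbol s_{\boldsymbol i})-f(\boldsymbol 1_d-\boldsymbol s_{\boldsymbol i})\big)\boldsymbol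 z^{\boldsymbol i}$. $\mathcal{I}_{\mathcal{P}}\subseteq\mathbb{Q}[\boldsymbol z]$ is the ideal of polynomials vanishing at the points $\boldsymbol 1_{d-1}$ and $\boldsymbol 1_{d-1}^{-j}$, $j=1,\dots,d-1$, where $\boldsymbol 1_{d-1}^{-j}$ has $-1$ in position $j$ and $1$ elsewhere. Two polynomials $P,Q\in\mathcal{I}_{\mathcal{P}}$ are equivalent if there is a constant $\mu>0$, $\mu\in\mathbb{Q}$, such that $P=\mu Q$. Type-0 pmf of a non-null $P=\sum_{\boldsymbol i\in\mathcal{X}_{d-1}}a_{\boldsymbol i}\boldsymbol z^{\boldsymbol i}\in\mathcal{I}_{\mathcal{P}}$: for each $\boldsymbol i\in\mathcal{X}_{d-1}$, if $a_{\boldsymbol i}\ge0$ put $g(\boldsymbol s_{\boldsymbol i})=a_{\boldsymbol i}$ and $g(\boldsymbol 1_d-\boldsymbol s_{\boldsymbol i})=0$; if $a_{\boldsymbol i}<0$ put $g(\boldsymbol s_{\boldsymbol i})=0$ and $g(\boldsymbol 1_d-\boldsymbol s_{\boldsymbol i})=-a_{\boldsymbol i}$. The type-0 pmf is $g/\sum_{\boldsymbol x\in\mathcal{X}_d}g(\boldsymbol x)$, which belongs to $\mathcal{SB}_d$. Set $M_d=m_d=d/2$ if $d$ is even, and $M_d=(d-1)/2$, $m_d=(d+1)/2$ if $d$ is odd. $\mathscr{I}^{\ast}_{d-1}=\{\boldsymbol i\in\mathcal{X}_{d-1}:\sum_{h=1}^{d-1}i_h=M_d\text{ or }\sum_{h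=1}^{d-1}i_h=m_d\}$.
   Formalization: As printed, λ real with μ rational fails (irrational λ gives H(f) outside Q[z]); the set equality is instead stated twice, with λ and μ both rational and with λ and μ both real, H taking real coefficients. *)

theory Defs
  imports "HOL-Probability.Probability" "HOL-Library.Poly_Mapping"
begin

text \<open>Vectors are lists and positions are counted from 0, so that \<open>x ! j\<close> is the coordinate
  usually numbered \<open>j + 1\<close>. A pmf on the binary cube is a \<^typ>\<open>nat list pmf\<close> whose support lies
  in the cube.\<close>

definition cube :: "nat \<Rightarrow> nat list set" where
  "cube n = {x. length x = n \<and> set x \<subseteq> {0, 1}}"

definition ones_minus :: "nat list \<Rightarrow> nat list" where
  "ones_minus x = map (\<lambda>b. 1 - b) x"

definition pad :: "nat list \<Rightarrow> nat list" where
  "pad i = i @ [0]"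

definition SB :: "nat \<Rightarrow> nat list pmf set" where
  "SB d = {f. set_pmf f \<subseteq> cube d \<and>
              (\<forall>j<d. map_pmf (\<lambda>x. x ! j) f = map_pmf of_bool (bernoulli_pmf (1/2)))}"

definition cx_le :: "'a measure \<Rightarrow> ('a \<Rightarrow> real) \<Rightarrow> 'b measure \<Rightarrow> ('b \<Rightarrow> real) \<Rightarrow> bool" where
  "cx_le M Y N Y' \<longleftrightarrow>
     integrable M Y \<and> integrable N Y' \<and>
     (\<forall>\<phi>. convex_on UNIV \<phi> \<longrightarrow> integrable M (\<lambda>x. \<phi> (Y x)) \<longrightarrow> integrable N (\<lambda>x. \<phi> (Y' x)) \<longrightarrow>
          (\<integral>x. \<phi> (Y x) \<partial>M) \<le> (\<integral>x. \<phi> (Y' x) \<partial>N))"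

text \<open>The convex order depends only on the laws of the two variables, so a random vector with pmf
  \<open>f\<close> is taken to be the identity on the probability space \<^term>\<open>measure_pmf f\<close>.\<close>

definition sum_cx_smallest :: "nat \<Rightarrow> nat list pmf \<Rightarrow> bool" where
  "sum_cx_smallest d f \<longleftrightarrow>
     f \<in> SB d \<and>
     (\<forall>f'\<in>SB d. cx_le (measure_pmf f) (\<lambda>x. real (sum_list x))
                       (measure_pmf f') (\<lambda>x. real (sum_list x)))"

text \<open>Polynomials are finitely supported maps from exponent vectors to coefficients, with the
  convolution product of \<^theory>\<open>HOL-Library.Poly_Mapping\<close>; the variables are numbered from 0.\<close>

type_synonym 'a mpoly = "(nat \<Rightarrow>\<^sub>0 nat) \<Rightarrow>\<^sub>0 'a"

definition poly_ring :: "nat \<Rightarrow> 'a::zero mpoly set" where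
  "poly_ring n = {P. \<forall>m\<in>Poly_Mapping.keys P. Poly_Mapping.keys m \<subseteq> {..<n}}"

definition eval_mpoly :: "(nat \<Rightarrow> 'a) \<Rightarrow> 'a::comm_ring_1 mpoly \<Rightarrow> 'a" where
  "eval_mpoly v P =
     (\<Sum>m\<in>Poly_Mapping.keys P.
        Poly_Mapping.lookup P m * (\<Prod>j\<in>Poly_Mapping.keys m. v j ^ Poly_Mapping.lookup m j))"

text \<open>The exponent vector of a list \<open>i\<close> is \<^term>\<open>Poly_Mapping.nth i\<close>, whose value at \<open>j\<close> is
  \<open>i ! j\<close>, and 0 past the end of \<open>i\<close>. So \<open>mterm c i\<close> is \<open>c\<close> times the monomial with exponent \<open>i\<close>.\<close>

definition mterm :: "'a::zero \<Rightarrow> nat list \<Rightarrow> 'a mpoly" where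
  "mterm c i = Poly_Mapping.single (Poly_Mapping.nth i) c"

definition mcoeff :: "'a::zero mpoly \<Rightarrow> nat list \<Rightarrow> 'a" where
  "mcoeff P i = Poly_Mapping.lookup P (Poly_Mapping.nth i)"

definition mscale :: "'a::semiring_0 \<Rightarrow> 'a mpoly \<Rightarrow> 'a mpoly" where
  "mscale c P = Poly_Mapping.single 0 c * P"

definition to_real_poly :: "rat mpoly \<Rightarrow> real mpoly" where
  "to_real_poly P = Poly_Mapping.map of_rat P"

definition ideal_IP :: "nat \<Rightarrow> rat mpoly set" where
  "ideal_IP d = {P \<in> poly_ring (d - 1).
     eval_mpoly (\<lambda>_. 1) P = 0 \<and>
     (\<forall>j<d - 1. eval_mpoly (\<lambda>h. if h = j then - 1 else 1) P = 0)}"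

definition poly_equivalent :: "'a::linordered_field mpoly \<Rightarrow> 'a mpoly \<Rightarrow> bool" where
  "poly_equivalent P Q \<longleftrightarrow> (\<exists>\<mu>>0. P = mscale \<mu> Q)"

text \<open>The pmfs are real valued, so \<open>\<H>\<close> has real coefficients; a pmf corresponds to the rational
  polynomial \<open>Q\<close> if its image is \<^term>\<open>to_real_poly Q\<close>.\<close>

definition H_map :: "nat \<Rightarrow> nat list pmf \<Rightarrow> real mpoly" where
  "H_map d f = (\<Sum>i\<in>cube (d - 1). mterm (pmf f (pad i) - pmf f (ones_minus (pad i))) i)"

text \<open>A point of the \<open>d\<close>-cube is \<^term>\<open>pad i\<close> if its last coordinate is 0 and
  \<^term>\<open>ones_minus (pad i)\<close> if it is 1, for a unique \<open>i\<close>.\<close>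

definition type0_weight :: "rat mpoly \<Rightarrow> nat list \<Rightarrow> rat" where
  "type0_weight P x =
     (if last x = 0
      then let a = mcoeff P (butlast x) in if a \<ge> 0 then a else 0
      else let a = mcoeff P (butlast (ones_minus x)) in if a < 0 then - a else 0)"

text \<open>Meaningful if \<open>P\<close> has a nonzero coefficient at some \<open>i \<in> cube (d - 1)\<close>; see
  \<open>pmf_type0\<close> below.\<close>

definition type0_pmf :: "nat \<Rightarrow> rat mpoly \<Rightarrow> nat list pmf" where
  "type0_pmf d P = embed_pmf (\<lambda>x. if x \<in> cube d
     then of_rat (type0_weight P x / (\<Sum>y\<in>cube d. type0_weight P y)) else 0)"

definition lower_level :: "nat \<Rightarrow> nat" where
  "lower_level d = (if even d then d div 2 else (d - 1) div 2)"

definition upper_level :: "nat \<Rightarrow> nat" where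
  "upper_level d = (if even d then d div 2 else (d + 1) div 2)"

definition central_indices :: "nat \<Rightarrow> nat list set" where
  "central_indices d =
     {i \<in> cube (d - 1). sum_list i = lower_level d \<or> sum_list i = upper_level d}"

lemma finite_cube: "finite (cube n)"
proof -
  have "cube n = {x. set x \<subseteq> {0, 1} \<and> length x = n}"
    by (auto simp: cube_def)
  then show ?thesis
    using finite_lists_length_eq[of "{0, 1::nat}" n] by simp
qed

lemma ones_minus_involutive: "set x \<subseteq> {0, 1} \<Longrightarrow> ones_minus (ones_minus x) = x"
  by (induction x) (auto simp: ones_minus_def)

lemma type0_weight_pad:
  "type0_weight P (pad i) = (if mcoeff P i \<ge> 0 then mcoeff P i else 0)"
  by (simp add: type0_weight_def pad_def Let_def)

lemma type0_weight_ones_minus_pad: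
  assumes "i \<in> cube n"
  shows "type0_weight P (ones_minus (pad i)) = (if mcoeff P i < 0 then - mcoeff P i else 0)"
proof -
  have "ones_minus (ones_minus (pad i)) = pad i"
    using assms by (intro ones_minus_involutive) (auto simp: pad_def cube_def)
  moreover have "last (ones_minus (pad i)) = 1"
    by (simp add: ones_minus_def pad_def)
  ultimately show ?thesis
    by (simp add: type0_weight_def pad_def Let_def)
qed

lemma type0_weight_nonneg: "type0_weight P x \<ge> 0"
  by (simp add: type0_weight_def Let_def)

lemma pmf_type0:
  assumes d: "d \<ge> 1" and i: "i \<in> cube (d - 1)" "mcoeff P i \<noteq> 0"
  shows "pmf (type0_pmf d P) x = (if x \<in> cube d
           then of_rat (type0_weight P x / (\<Sum>y\<in>cube d. type0_weight P y)) else 0)"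
proof -
  let ?S = "\<Sum>y\<in>cube d. type0_weight P y"
  let ?f = "\<lambda>x. if x \<in> cube d then real_of_rat (type0_weight P x / ?S) else 0"
  have mem: "pad i \<in> cube d" "ones_minus (pad i) \<in> cube d"
    using d i(1) by (auto simp: pad_def cube_def ones_minus_def)
  have "type0_weight P (pad i) > 0 \<or> type0_weight P (ones_minus (pad i)) > 0"
    using i(2) by (auto simp: type0_weight_pad type0_weight_ones_minus_pad[OF i(1)])
  with mem have S: "?S > 0"
    using finite_cube type0_weight_nonneg by (metis sum_pos2)
  have nn: "?f x \<ge> 0" for x
    using S type0_weight_nonneg[of P x] by simp
  have "(\<integral>\<^sup>+x. ennreal (?f x) \<partial>count_space UNIV) = (\<Sum>x\<in>cube d. ennreal (?f x))"
    by (rule nn_integral_count_space'[OF finite_cube]) auto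
  also have "\<dots> = ennreal (\<Sum>x\<in>cube d. ?f x)"
    by (rule sum_ennreal) (rule nn)
  also have "(\<Sum>x\<in>cube d. ?f x) = real_of_rat (\<Sum>x\<in>cube d. type0_weight P x / ?S)"
    by (simp add: of_rat_sum)
  also have "(\<Sum>x\<in>cube d. type0_weight P x / ?S) = 1"
    using S by (simp flip: sum_divide_distrib)
  finally have "(\<integral>\<^sup>+x. ennreal (?f x) \<partial>count_space UNIV) = 1"
    by simp
  from pmf_embed_pmf[of ?f, OF nn this] show ?thesis
    unfolding type0_pmf_def .
qed

lemma nth_inject: "length i = length k \<Longrightarrow> Poly_Mapping.nth i = Poly_Mapping.nth k \<Longrightarrow> i = k"
  by (metis lookup_nth nth_default_nth nth_equalityI)

lemma mcoeff_sum_mterm: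
  assumes "k \<in> cube n"
  shows "mcoeff (\<Sum>i\<in>cube n. mterm (a i) i) k = a k"
proof -
  have "mcoeff (\<Sum>i\<in>cube n. mterm (a i) i) k = (\<Sum>i\<in>cube n. if i = k then a i else 0)"
    unfolding mcoeff_def mterm_def lookup_sum
    using assms by (intro sum.cong) (auto simp: lookup_single cube_def when_def dest: nth_inject)
  then show ?thesis
    using assms by (simp add: finite_cube)
qed

end

theory Submission
  imports Defs
begin

text \<open>Every member of \<open>SB d\<close> has expected coordinate sum \<open>d / 2\<close>. A convex function lies above
  its chord over the interval from \<open>lower_level d\<close> to \<open>lower_level d + 1\<close> at all integers, so a
  member supported on the central levels is smallest; testing with the convex function
  \<open>\<bar>x - d / 2\<bar>\<close> shows that nothing else is smallest once such a member exists. Conditions (2) and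
  (3) say that the type-0 pmf has the right marginals and condition (1) that it is supported on the
  central levels. If \<open>f\<close> is smallest with polynomial \<open>\<mu> P\<close>, then \<open>f \<ge> \<lambda> f\<^sup>*\<close> pointwise for
  \<open>\<lambda> = \<mu> \<Sum> \<bar>a\<^sub>i\<bar>\<close>, and the normalised difference is the pmf with null polynomial; if it vanishes,
  the symmetrisation of \<open>f\<^sup>*\<close> serves instead.\<close>

section \<open>The cube and its pmfs\<close>

lemma cubeD: "x \<in> cube n \<Longrightarrow> length x = n" "x \<in> cube n \<Longrightarrow> j < n \<Longrightarrow> x ! j = 0 \<or> x ! j = 1"
  by (auto simp: cube_def dest!: nth_mem)

lemma real_sum_list_cube: "x \<in> cube n \<Longrightarrow> real (sum_list x) = (\<Sum>j<n. real (x ! j))"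
  by (simp add: cube_def sum_list_sum_nth atLeast0LessThan)

lemma ones_minus_cube: "x \<in> cube n \<Longrightarrow> ones_minus x \<in> cube n"
  by (auto simp: cube_def ones_minus_def)

lemma ones_minus_cube_involutive: "x \<in> cube n \<Longrightarrow> ones_minus (ones_minus x) = x"
  by (rule ones_minus_involutive) (simp add: cube_def)

lemma nth_ones_minus:
  assumes "x \<in> cube n" "j < n"
  shows "real (ones_minus x ! j) = 1 - real (x ! j)"
  using cubeD[OF assms(1)] assms(2) by (force simp: ones_minus_def)

lemma sum_list_ones_minus:
  assumes "x \<in> cube n"
  shows "sum_list (ones_minus x) = n - sum_list x" "sum_list x \<le> n"
proof -
  have "sum_list (ones_minus x) + sum_list x = length x" if "set x \<subseteq> {0, 1}" for x
    using that by (induction x) (auto simp: ones_minus_def)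
  from this[of x] assms show "sum_list (ones_minus x) = n - sum_list x" "sum_list x \<le> n"
    by (auto simp: cube_def)
qed

lemma pad_cube: "d \<ge> 1 \<Longrightarrow> i \<in> cube (d - 1) \<Longrightarrow> pad i \<in> cube d"
  by (auto simp: pad_def cube_def)

lemma bij_betw_ones_minus: "bij_betw ones_minus (cube n) (cube n)"
  by (rule bij_betwI[where g = ones_minus])
     (auto simp: ones_minus_cube ones_minus_cube_involutive)

text \<open>The last coordinate decides the case; if it is 1, the index is the complement of
  \<open>butlast x\<close>.\<close>

lemma cube_cases:
  assumes "d \<ge> 1" "x \<in> cube d"
  obtains i where "i \<in> cube (d - 1)" "x = pad i"
    | i where "i \<in> cube (d - 1)" "x = ones_minus (pad i)"
proof -
  have x: "x \<noteq> []" "length x = d" "set x \<subseteq> {0, 1}"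
    using assms by (auto simp: cube_def)
  have b: "butlast x \<in> cube (d - 1)"
    using x by (auto simp: cube_def dest: in_set_butlastD)
  have "last x \<in> {0, 1}"
    using x last_in_set by blast
  then show thesis
  proof (elim insertE emptyE)
    assume "last x = 0"
    then have "x = pad (butlast x)"
      using x(1) by (simp add: pad_def append_butlast_last_id flip: \<open>last x = 0\<close>)
    with b that(1) show thesis by blast
  next
    assume l: "last x = 1"
    have "ones_minus x = pad (ones_minus (butlast x))"
      using x(1) l by (metis ones_minus_def pad_def append_butlast_last_id diff_self_eq_0
          list.simps(8,9) map_append)
    then have "x = ones_minus (pad (ones_minus (butlast x)))"
      using ones_minus_cube_involutive[OF assms(2)] by simp
    with b that(2) show thesis
      using ones_minus_cube by blast
  qed
qed

text \<open>Pairs each point with its complement, the form in which \<open>H_map\<close> and the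
  type-0 weights are given.\<close>

lemma sum_cube_split:
  fixes h :: "nat list \<Rightarrow> 'a::comm_monoid_add"
  assumes "d \<ge> 1"
  shows "(\<Sum>x\<in>cube d. h x) = (\<Sum>i\<in>cube (d - 1). h (pad i) + h (ones_minus (pad i)))"
proof -
  let ?p = "\<lambda>i. ones_minus (pad i)"
  have mem: "pad i \<in> cube d" "?p i \<in> cube d" if "i \<in> cube (d - 1)" for i
    using that assms by (simp_all add: pad_cube ones_minus_cube)
  have eq: "cube d = pad ` cube (d - 1) \<union> ?p ` cube (d - 1)"
    using mem by (auto elim!: cube_cases[OF assms])
  have disj: "pad ` cube (d - 1) \<inter> ?p ` cube (d - 1) = {}"
    by (auto simp: pad_def ones_minus_def)
  have inj1: "inj_on pad (cube (d - 1))"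
    by (auto simp: inj_on_def pad_def)
  have inj2: "inj_on ?p (cube (d - 1))"
    using bij_betw_ones_minus[of d] inj1 mem(1)
    unfolding inj_on_def bij_betw_def by blast
  have "(\<Sum>x\<in>cube d. h x) = (\<Sum>x\<in>pad ` cube (d - 1). h x) + (\<Sum>x\<in>?p ` cube (d - 1). h x)"
    unfolding eq by (rule sum.union_disjoint) (use disj finite_cube in auto)
  then show ?thesis
    by (simp add: sum.reindex[OF inj1] sum.reindex[OF inj2] sum.distrib del: One_nat_def)
qed

lemma obtain_pmf:
  fixes w :: "'a \<Rightarrow> real"
  assumes "finite A" "\<And>x. w x \<ge> 0" "\<And>x. x \<notin> A \<Longrightarrow> w x = 0" "(\<Sum>x\<in>A. w x) = 1"
  obtains f where "\<And>x. pmf f x = w x"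
proof -
  have "(\<integral>\<^sup>+x. ennreal (w x) \<partial>count_space UNIV) = (\<Sum>x\<in>A. ennreal (w x))"
    by (rule nn_integral_count_space'[OF assms(1)]) (use assms(3) in auto)
  also have "\<dots> = 1"
    using assms by (simp add: sum_ennreal)
  finally have "pmf (embed_pmf w) x = w x" for x
    by (intro pmf_embed_pmf assms)
  with that show thesis by blast
qed

text \<open>The total mass is 1, so a law on two points is determined by a single mass.\<close>

lemma pmf_eq_bernoulli_iff:
  fixes p :: "nat pmf"
  assumes "set_pmf p \<subseteq> {0, 1}"
  shows "p = map_pmf of_bool (bernoulli_pmf (1/2)) \<longleftrightarrow> pmf p 1 = 1 / 2"
proof -
  let ?b = "map_pmf of_bool (bernoulli_pmf (1/2)) :: nat pmf"
  have inj: "inj (of_bool :: bool \<Rightarrow> nat)"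
    by (auto simp: inj_def)
  have b: "pmf ?b 1 = 1 / 2" "pmf ?b 0 = 1 / 2"
    using pmf_map_inj'[OF inj, of "bernoulli_pmf (1/2)" True]
      pmf_map_inj'[OF inj, of "bernoulli_pmf (1/2)" False] by auto
  have p: "pmf p 0 + pmf p 1 = 1"
    using sum_pmf_eq_1[OF _ assms] by simp
  have "pmf p k = pmf ?b k" if "pmf p 1 = 1 / 2" for k
  proof (cases "k \<in> {0, 1}")
    case True
    then show ?thesis using that p b by auto
  next
    case False
    then have "k \<notin> set_pmf p" "k \<notin> set_pmf ?b"
      using assms by auto
    then show ?thesis by (simp only: pmf_eq_0_set_pmf[symmetric])
  qed
  then show ?thesis
    using b(1) by (auto intro: pmf_eqI)
qed

lemma expectation_cube:
  fixes h :: "nat list \<Rightarrow> real"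
  assumes "set_pmf f \<subseteq> cube d"
  shows "measure_pmf.expectation f h = (\<Sum>x\<in>cube d. pmf f x * h x)"
  using integral_measure_pmf_real[OF finite_cube, of f h d] assms
  by (simp add: mult.commute subset_iff)

text \<open>The mass at 1 of a 0/1 coordinate is its mean. The marginal conditions thus become
  linear in the point masses, which suits mixtures, differences and symmetrisations.\<close>

lemma SB_iff:
  "f \<in> SB d \<longleftrightarrow>
     set_pmf f \<subseteq> cube d \<and> (\<forall>j<d. (\<Sum>x\<in>cube d. pmf f x * real (x ! j)) = 1 / 2)"
proof -
  have "map_pmf (\<lambda>x. x ! j) f = map_pmf of_bool (bernoulli_pmf (1/2)) \<longleftrightarrow>
      (\<Sum>x\<in>cube d. pmf f x * real (x ! j)) = 1 / 2"
    if f: "set_pmf f \<subseteq> cube d" and j: "j < d" for j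
  proof -
    have 01: "x ! j = 0 \<or> x ! j = 1" if "x \<in> set_pmf f" for x
      using f j that cubeD(2) by blast
    have "pmf (map_pmf (\<lambda>x. x ! j) f) 1 = measure_pmf.expectation f (indicator {x. x ! j = 1})"
      by (simp add: pmf_map vimage_def)
    also have "\<dots> = measure_pmf.expectation f (\<lambda>x. real (x ! j))"
      using 01 by (intro integral_cong_AE) (fastforce simp: AE_measure_pmf_iff indicator_def)+
    finally show ?thesis
      using 01 by (subst pmf_eq_bernoulli_iff) (force simp: expectation_cube[OF f])+
  qed
  then show ?thesis
    unfolding SB_def by blast
qed

text \<open>Because the mean is common to the whole class, affine functions of the sum cannot tell
  its members apart.\<close>

lemma expectation_sum_list_SB:
  assumes "f \<in> SB d"
  shows "measure_pmf.expectation f (\<lambda>x. real (sum_list x)) = real d / 2"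
proof -
  from assms have f: "set_pmf f \<subseteq> cube d"
    and m: "\<And>j. j < d \<Longrightarrow> (\<Sum>x\<in>cube d. pmf f x * real (x ! j)) = 1 / 2"
    by (auto simp: SB_iff)
  have "measure_pmf.expectation f (\<lambda>x. real (sum_list x))
      = (\<Sum>x\<in>cube d. \<Sum>j<d. pmf f x * real (x ! j))"
    unfolding expectation_cube[OF f]
    by (intro sum.cong refl) (simp add: real_sum_list_cube sum_distrib_left)
  also have "\<dots> = (\<Sum>j<d. \<Sum>x\<in>cube d. pmf f x * real (x ! j))"
    by (rule sum.swap)
  also have "\<dots> = real d / 2"
    by (simp add: m)
  finally show ?thesis .
qed

lemma integrable_SB:
  fixes h :: "nat list \<Rightarrow> real"
  assumes "f \<in> SB d"
  shows "integrable (measure_pmf f) h"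
  using assms finite_subset[OF _ finite_cube]
  by (intro integrable_measure_pmf_finite) (auto simp: SB_iff)

section \<open>Smallest elements in the convex order\<close>

text \<open>The counterpart of \<open>central_indices\<close> one dimension up: for \<open>i\<close>
  in the smaller cube, \<open>pad i\<close> belongs to it exactly when \<open>i\<close> is a central
  index.\<close>

definition central_cube :: "nat \<Rightarrow> nat list set" where
  "central_cube d = {x \<in> cube d. sum_list x = lower_level d \<or> sum_list x = upper_level d}"

text \<open>If nonempty, this is exactly the set of smallest pmfs, and unlike that set it is given
  by linear conditions.\<close>

definition central_SB :: "nat \<Rightarrow> nat list pmf set" where
  "central_SB d = {f \<in> SB d. set_pmf f \<subseteq> central_cube d}"

lemma upper_level_eq: "upper_level d = d - lower_level d"
  and lower_level_le: "lower_level d \<le> d"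
  by (auto simp: upper_level_def lower_level_def elim!: evenE oddE)

lemma upper_level_cases: "upper_level d = lower_level d \<or> upper_level d = Suc (lower_level d)"
  by (cases "even d") (auto simp: upper_level_def lower_level_def elim!: oddE)

text \<open>The central levels are the integers nearest to \<open>d / 2\<close>, at distance 0 for
  even \<open>d\<close> and 1/2 for odd \<open>d\<close>.\<close>

lemma level_deviation:
  fixes k :: nat
  shows "real (upper_level d) - real d / 2 \<le> \<bar>real k - real d / 2\<bar>" (is "?c \<le> _")
    and "\<bar>real k - real d / 2\<bar> = real (upper_level d) - real d / 2 \<longleftrightarrow>
      k = lower_level d \<or> k = upper_level d"
proof -
  consider m where "d = 2 * m" "lower_level d = m" "upper_level d = m"
    | m where "d = 2 * m + 1" "lower_level d = m" "upper_level d = m + 1"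
    by (cases "even d") (auto simp: lower_level_def upper_level_def elim!: evenE oddE)
  then have "?c \<le> \<bar>real k - real d / 2\<bar> \<and> (\<bar>real k - real d / 2\<bar> = ?c \<longleftrightarrow>
      k = lower_level d \<or> k = upper_level d)"
  proof cases
    case (1 m)
    then show ?thesis by auto
  next
    case (2 m)
    then show ?thesis by (cases "k \<le> m") (auto simp: field_simps)
  qed
  then show "?c \<le> \<bar>real k - real d / 2\<bar>"
    and "\<bar>real k - real d / 2\<bar> = ?c \<longleftrightarrow> k = lower_level d \<or> k = upper_level d"
    by blast+
qed

text \<open>Outside its interval the line of a chord lies below a convex function, and no integer
  lies strictly between \<open>n\<close> and \<open>n + 1\<close>.\<close>

lemma convex_above_unit_chord:
  fixes \<phi> :: "real \<Rightarrow> real" and k n :: nat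
  assumes "convex_on UNIV \<phi>"
  shows "\<phi> (real n) + (\<phi> (real n + 1) - \<phi> (real n)) * (real k - real n) \<le> \<phi> (real k)"
proof -
  consider "k = n" | "k = n + 1" | "k < n" | "k > n + 1"
    by linarith
  then show ?thesis
  proof cases
    case 3
    \<comment> \<open>Now \<open>n\<close> lies between \<open>k\<close> and \<open>n + 1\<close>;
      the chord bound at \<open>n\<close>, solved for the value at \<open>k\<close>, is the
      claim.\<close>
    have "\<phi> (real n) \<le> (\<phi> k - \<phi> (n + 1)) / (real (n + 1) - k) * (real (n + 1) - n) + \<phi> (n + 1)"
      using 3 by (intro convex_onD_Icc'' convex_on_subset[OF assms]) auto
    with 3 show ?thesis by (simp add: field_simps)
  next
    case 4
    have "\<phi> (real n + 1) \<le> (\<phi> k - \<phi> n) / (real k - n) * (real n + 1 - n) + \<phi> n"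
      using 4 by (intro convex_onD_Icc' convex_on_subset[OF assms]) auto
    with 4 show ?thesis by (simp add: field_simps)
  qed (auto simp: add.commute)
qed

text \<open>The affine \<open>l\<close> agrees with \<open>\<phi>\<close> on the support of
  \<open>f\<close>, stays below \<open>\<phi>\<close> at all integers, and has the same expectation
  under \<open>f\<close> and \<open>f'\<close>.\<close>

lemma central_SB_smallest:
  assumes "f \<in> central_SB d"
  shows "sum_cx_smallest d f"
proof -
  have f: "f \<in> SB d" and supp: "set_pmf f \<subseteq> central_cube d"
    using assms by (auto simp: central_SB_def)
  let ?E = "measure_pmf.expectation" and ?S = "\<lambda>x. real (sum_list x)"
  have "?E f (\<lambda>x. \<phi> (?S x)) \<le> ?E f' (\<lambda>x. \<phi> (?S x))"
    if f': "f' \<in> SB d" and \<phi>: "convex_on UNIV \<phi>" for f' \<phi>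
  proof -
    define n where "n = lower_level d"
    define s where "s = \<phi> (real n + 1) - \<phi> (real n)"
    \<comment> \<open>The line through the graph of \<open>\<phi>\<close> at \<open>n\<close> and
      \<open>n + 1\<close>. For even \<open>d\<close> both central levels equal \<open>n\<close>,
      and the same line serves.\<close>
    define l where "l = (\<lambda>x::real. (\<phi> (real n) - s * real n) + s * x)"
    have l: "?E g (\<lambda>x. l (?S x)) = (\<phi> (real n) - s * real n) + s * (real d / 2)"
      if "g \<in> SB d" for g
      unfolding l_def
      using expectation_sum_list_SB[OF that]
      by (subst Bochner_Integration.integral_add)
        (auto intro!: integrable_SB[OF that])
    have "?E f (\<lambda>x. \<phi> (?S x)) = ?E f (\<lambda>x. l (?S x))"
    proof (intro integral_cong_AE)
      have "\<phi> (?S x) = l (?S x)" if "x \<in> set_pmf f" for x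
      proof -
        have "sum_list x = n \<or> sum_list x = Suc n"
          using supp that upper_level_cases[of d] by (auto simp: central_cube_def n_def)
        then show ?thesis
          by (auto simp: l_def s_def algebra_simps)
      qed
      then show "AE x in measure_pmf f. \<phi> (?S x) = l (?S x)"
        by (simp add: AE_measure_pmf_iff)
    qed auto
    also have "\<dots> = ?E f' (\<lambda>x. l (?S x))"
      by (simp only: l f f')
    also have "\<dots> \<le> ?E f' (\<lambda>x. \<phi> (?S x))"
      by (intro integral_mono integrable_SB[OF f'])
        (use convex_above_unit_chord[OF \<phi>, of n] in \<open>simp add: l_def s_def algebra_simps\<close>)
    finally show ?thesis .
  qed
  then show ?thesis
    unfolding sum_cx_smallest_def cx_le_def using f integrable_SB by blast
qed

text \<open>The mean distance of the sum from \<open>d / 2\<close> is at least \<open>c\<close>, and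
  \<open>g\<close> attains \<open>c\<close>; a smallest \<open>f\<close> must attain it too.\<close>

lemma sum_cx_smallest_central:
  assumes ex: "g \<in> central_SB d" and small: "sum_cx_smallest d f"
  shows "f \<in> central_SB d"
proof -
  define h where "h = (\<lambda>y. \<bar>y - real d / 2\<bar>)"
  define c where "c = real (upper_level d) - real d / 2"
  let ?E = "measure_pmf.expectation" and ?S = "\<lambda>x. real (sum_list x)"
  have f: "f \<in> SB d"
    and g: "g \<in> SB d" "set_pmf g \<subseteq> central_cube d"
    using ex small by (auto simp: central_SB_def sum_cx_smallest_def)
  have "convex_on UNIV h"
    using convex_on_dist[of UNIV "real d / 2"]
    by (simp add: h_def dist_real_def abs_minus_commute)
  then have "?E f (\<lambda>x. h (?S x)) \<le> ?E g (\<lambda>x. h (?S x))"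
    using small g(1) integrable_SB[OF f] integrable_SB[OF g(1)]
    unfolding sum_cx_smallest_def cx_le_def by blast
  also have "\<dots> = ?E g (\<lambda>_. c)"
    using g(2) level_deviation(2)[of _ d]
    by (intro integral_cong_AE) (auto simp: AE_measure_pmf_iff central_cube_def h_def c_def)
  finally have "?E f (\<lambda>x. h (?S x) - c) \<le> 0"
    using integrable_SB[OF f] by (subst Bochner_Integration.integral_diff) auto
  moreover have nn: "h (?S x) - c \<ge> 0" for x
    using level_deviation(1)[of d "sum_list x"] by (simp add: h_def c_def)
  ultimately have "?E f (\<lambda>x. h (?S x) - c) = 0"
    by (meson Bochner_Integration.integral_nonneg order_antisym)
  \<comment> \<open>A nonnegative function with mean 0 vanishes on the whole support.\<close>
  then have "AE x in measure_pmf f. h (?S x) - c = 0"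
    using integral_nonneg_eq_0_iff_AE[OF integrable_SB[OF f]] nn by simp
  then have "sum_list x = lower_level d \<or> sum_list x = upper_level d" if "x \<in> set_pmf f" for x
    using that level_deviation(2)[of "sum_list x" d]
    by (simp add: AE_measure_pmf_iff h_def c_def)
  then show ?thesis
    using f by (auto simp: central_SB_def central_cube_def SB_iff)
qed

lemma central_SB_iff:
  "f \<in> central_SB d \<longleftrightarrow> (\<forall>x. x \<notin> central_cube d \<longrightarrow> pmf f x = 0) \<and>
     (\<forall>j<d. (\<Sum>x\<in>cube d. pmf f x * real (x ! j)) = 1 / 2)"
  by (auto simp: central_SB_def SB_iff central_cube_def set_pmf_iff)

lemma central_SB_mixture:
  assumes "f1 \<in> central_SB d" "f2 \<in> central_SB d"
    and f: "\<And>x. pmf f x = u * pmf f1 x + (1 - u) * pmf f2 x"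
  shows "f \<in> central_SB d"
proof -
  have mix: "(\<Sum>x\<in>cube d. pmf f x * real (x ! j)) =
      u * (\<Sum>x\<in>cube d. pmf f1 x * real (x ! j)) +
      (1 - u) * (\<Sum>x\<in>cube d. pmf f2 x * real (x ! j))" for j
    by (simp add: f sum_distrib_left algebra_simps flip: sum.distrib)
  have "(\<Sum>x\<in>cube d. pmf f x * real (x ! j)) = 1 / 2" if "j < d" for j
  proof -
    have "(\<Sum>x\<in>cube d. pmf f1 x * real (x ! j)) = 1 / 2"
      "(\<Sum>x\<in>cube d. pmf f2 x * real (x ! j)) = 1 / 2"
      using assms(1,2) that by (auto simp: central_SB_iff)
    then show ?thesis
      unfolding mix by (simp add: field_simps)
  qed
  then show ?thesis
    using assms by (simp add: central_SB_iff)
qed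

text \<open>The converse of mixing: the difference is nonnegative with mass \<open>1 - u\<close>,
  and its normalisation keeps the marginals, as \<open>(1/2 - u/2) / (1 - u)\<close> is 1/2.\<close>

lemma central_SB_remainder:
  assumes "f1 \<in> central_SB d" "f \<in> central_SB d" "u < 1"
    and le: "\<And>x. u * pmf f1 x \<le> pmf f x"
  obtains f2 where "f2 \<in> central_SB d" "\<And>x. pmf f x = u * pmf f1 x + (1 - u) * pmf f2 x"
proof -
  define w where "w = (\<lambda>x. (pmf f x - u * pmf f1 x) / (1 - u))"
  have tot: "(\<Sum>x\<in>cube d. pmf g x) = 1" if "g \<in> central_SB d" for g
    using that by (intro sum_pmf_eq_1 finite_cube) (auto simp: central_SB_def SB_iff)
  \<comment> \<open>Used with \<open>h\<close> constantly 1 for the total mass and with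
    \<open>h\<close> a coordinate for the marginals.\<close>
  have sum: "(\<Sum>x\<in>cube d. w x * h x) =
      ((\<Sum>x\<in>cube d. pmf f x * h x) - u * (\<Sum>x\<in>cube d. pmf f1 x * h x)) / (1 - u)" for h
    by (simp add: w_def sum_distrib_left sum_divide_distrib left_diff_distrib mult.assoc
        flip: sum_subtractf)
  have z: "w x = 0" if "x \<notin> central_cube d" for x
    using that assms by (simp add: w_def central_SB_iff)
  obtain f2 where f2: "\<And>x. pmf f2 x = w x"
  proof (rule obtain_pmf[OF finite_cube[of d], of w])
    show "w x \<ge> 0" for x
      using le[of x] \<open>u < 1\<close> by (simp add: w_def)
    show "w x = 0" if "x \<notin> cube d" for x
      using that by (intro z) (auto simp: central_cube_def)
    show "(\<Sum>x\<in>cube d. w x) = 1"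
      using sum[of "\<lambda>_. 1"] tot[OF assms(1)] tot[OF assms(2)] \<open>u < 1\<close> by simp
  qed blast
  have "(\<Sum>x\<in>cube d. w x * real (x ! j)) = 1 / 2" if "j < d" for j
    using assms that unfolding sum by (simp add: central_SB_iff field_simps)
  then have "f2 \<in> central_SB d"
    using z by (simp add: central_SB_iff f2)
  moreover have "pmf f x = u * pmf f1 x + (1 - u) * pmf f2 x" for x
    using \<open>u < 1\<close> by (simp add: f2 w_def)
  ultimately show thesis
    by (rule that)
qed

text \<open>Complementation sends level \<open>k\<close> to \<open>d - k\<close> and so exchanges
  the two central levels.\<close>

lemma ones_minus_central_cube:
  assumes "x \<in> cube d"
  shows "ones_minus x \<in> central_cube d \<longleftrightarrow> x \<in> central_cube d"
  using assms sum_list_ones_minus[OF assms] upper_level_eq[of d] lower_level_le[of d]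
  by (auto simp: central_cube_def ones_minus_cube)

section \<open>Polynomials with exponents in the cube\<close>

lemma sum_mterm_eq_iff:
  "(\<Sum>i\<in>cube n. mterm (a i) i) = (\<Sum>i\<in>cube n. mterm (b i) i) \<longleftrightarrow> (\<forall>i\<in>cube n. a i = b i)"
  by (metis (no_types, lifting) mcoeff_sum_mterm sum.cong)

lemma mscale_sum_mterm:
  "mscale c (\<Sum>i\<in>cube n. mterm (a i) i) = (\<Sum>i\<in>cube n. mterm (c * a i) i)"
  by (simp add: mscale_def mterm_def sum_distrib_left mult_single)

lemma lookup_mscale: "Poly_Mapping.lookup (mscale c P) m = c * Poly_Mapping.lookup P m"
  unfolding mscale_def mult_map_scale_conv_mult[symmetric]
  by (simp add: Poly_Mapping.map.rep_eq when_def)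

lemma to_real_poly_sum_mterm:
  "to_real_poly (\<Sum>i\<in>A. mterm (a i) i) = (\<Sum>i\<in>A. mterm (of_rat (a i)) i)"
proof (rule poly_mapping_eqI)
  fix m
  have "Poly_Mapping.lookup (to_real_poly Q) m = of_rat (Poly_Mapping.lookup Q m)" for Q
    by (simp add: to_real_poly_def Poly_Mapping.map.rep_eq when_def)
  then show "Poly_Mapping.lookup (to_real_poly (\<Sum>i\<in>A. mterm (a i) i)) m =
      Poly_Mapping.lookup (\<Sum>i\<in>A. mterm (of_rat (a i)) i) m"
    by (simp add: lookup_sum mterm_def lookup_single of_rat_sum when_def if_distrib[of of_rat]
        cong: if_cong)
qed

lemma mscale_ideal_IP:
  assumes "c \<noteq> 0" "P \<in> ideal_IP d"
  shows "mscale c P \<in> ideal_IP d"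
proof -
  \<comment> \<open>\<open>eval_mpoly\<close> sums over the keys, and a nonzero factor leaves them
    unchanged.\<close>
  have keys: "Poly_Mapping.keys (mscale c P) = Poly_Mapping.keys P"
    using assms(1) by (auto simp: in_keys_iff lookup_mscale)
  have "eval_mpoly v (mscale c P) = c * eval_mpoly v P" for v
    by (simp add: eval_mpoly_def keys lookup_mscale sum_distrib_left mult.assoc)
  then show ?thesis
    using assms(2) by (simp add: ideal_IP_def poly_ring_def keys)
qed

section \<open>The type-0 pmf\<close>

text \<open>\<open>T\<close> is the total type-0 weight, so \<open>f\<close> below is the type-0 pmf of the polynomial with
  coefficients \<open>a\<close>.\<close>

locale type0 =
  fixes d :: nat and a :: "nat list \<Rightarrow> real" and T :: real and f :: "nat list pmf"
  assumes d: "d \<ge> 1"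
    and T: "T > 0"
    and outside: "x \<notin> cube d \<Longrightarrow> pmf f x = 0"
    and pmf_pad: "i \<in> cube (d - 1) \<Longrightarrow> pmf f (pad i) = max (a i) 0 / T"
    and pmf_ones_minus_pad: "i \<in> cube (d - 1) \<Longrightarrow> pmf f (ones_minus (pad i)) = max (- a i) 0 / T"
begin

text \<open>Positive part minus negative part: the type-0 pmf has the original polynomial divided by
  \<open>T\<close> as its image.\<close>

lemma diff_eq:
  assumes "i \<in> cube (d - 1)"
  shows "pmf f (pad i) - pmf f (ones_minus (pad i)) = a i / T"
  using T assms by (simp add: pmf_pad pmf_ones_minus_pad max_def field_simps)

text \<open>The sign \<open>2 * x ! j - 1\<close> is odd under complementation, so a complementary
  pair contributes its sign times \<open>a i / T\<close>. The two hypotheses make these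
  contributions cancel; a sign of mean 0 is a coordinate of mean 1/2.\<close>

lemma marginal:
  assumes total: "(\<Sum>i\<in>cube (d - 1). a i) = 0"
    and cont: "\<And>j. j < d - 1 \<Longrightarrow> (\<Sum>i\<in>cube (d - 1). a i * real (i ! j)) = 0"
    and j: "j < d"
  shows "(\<Sum>x\<in>cube d. pmf f x * real (x ! j)) = 1 / 2"
proof -
  have sub: "set_pmf f \<subseteq> cube d"
    using outside by (metis set_pmf_iff subsetI)
  have "0 = (\<Sum>i\<in>cube (d - 1). (2 * real (pad i ! j) - 1) * a i)"
  proof (cases "j < d - 1")
    case True
    have "(\<Sum>i\<in>cube (d - 1). (2 * real (pad i ! j) - 1) * a i) =
        (\<Sum>i\<in>cube (d - 1). 2 * (a i * real (i ! j)) - a i)"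
      using True by (intro sum.cong) (auto simp: pad_def nth_append cube_def algebra_simps)
    then show ?thesis
      using total cont[OF True] by (simp add: sum_subtractf flip: sum_distrib_left)
  next
    case False
    \<comment> \<open>This is the padded position \<open>j = d - 1\<close>: the sign is constantly
      -1, so only the total of the coefficients enters.\<close>
    then have "pad i ! j = 0" if "i \<in> cube (d - 1)" for i
      using that j by (auto simp: pad_def nth_append cube_def)
    then show ?thesis
      using total by (simp add: sum_negf)
  qed
  also have "\<dots> = (\<Sum>i\<in>cube (d - 1). T * (pmf f (pad i) * (2 * real (pad i ! j) - 1) +
      pmf f (ones_minus (pad i)) * (2 * real (ones_minus (pad i) ! j) - 1)))"
  proof (intro sum.cong refl)
    fix i assume i: "i \<in> cube (d - 1)"
    have a: "a i = T * (pmf f (pad i) - pmf f (ones_minus (pad i)))"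
      using diff_eq[OF i] T by simp
    show "(2 * real (pad i ! j) - 1) * a i = T * (pmf f (pad i) * (2 * real (pad i ! j) - 1) +
        pmf f (ones_minus (pad i)) * (2 * real (ones_minus (pad i) ! j) - 1))"
      unfolding a nth_ones_minus[OF pad_cube[OF d i] j] by (simp add: algebra_simps)
  qed
  also have "\<dots> = T * (\<Sum>x\<in>cube d. pmf f x * (2 * real (x ! j) - 1))"
    by (simp add: sum_cube_split[OF d] flip: sum_distrib_left)
  also have "(\<Sum>x\<in>cube d. pmf f x * (2 * real (x ! j) - 1)) =
      2 * (\<Sum>x\<in>cube d. pmf f x * real (x ! j)) - (\<Sum>x\<in>cube d. pmf f x)"
    by (simp add: algebra_simps sum_subtractf sum_distrib_left)
  also have "(\<Sum>x\<in>cube d. pmf f x) = 1"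
    by (rule sum_pmf_eq_1[OF finite_cube sub])
  finally show ?thesis
    using T by simp
qed

text \<open>A zero coefficient removes both points of its complementary pair, and these are both
  central or both not.\<close>

lemma supported_central:
  assumes "\<And>i. i \<in> cube (d - 1) \<Longrightarrow> i \<notin> central_indices d \<Longrightarrow> a i = 0"
    and "x \<notin> central_cube d"
  shows "pmf f x = 0"
proof (cases "x \<in> cube d")
  case True
  have "pad i \<in> central_cube d \<longleftrightarrow> i \<in> central_indices d" if "i \<in> cube (d - 1)" for i
    using that pad_cube[OF d that] by (auto simp: central_cube_def central_indices_def pad_def)
  with d True assms show ?thesis
    by (elim cube_cases)
      (auto simp: pmf_pad pmf_ones_minus_pad ones_minus_central_cube[OF pad_cube[OF d]]
        simp del: One_nat_def)
qed (rule outside)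

text \<open>Two nonnegative masses with difference \<open>c * a i\<close> are at least the positive
  and negative parts of \<open>c * a i\<close>; the type-0 pmf has exactly these parts, up to
  scaling.\<close>

lemma scaled_le:
  assumes g: "\<And>i. i \<in> cube (d - 1) \<Longrightarrow> pmf g (pad i) - pmf g (ones_minus (pad i)) = c * a i"
    and "c > 0"
  shows "c * T * pmf f x \<le> pmf g x"
proof (cases "x \<in> cube d")
  case True
  have *: "c * max r 0 \<le> y" if "0 \<le> y" "c * r \<le> y" for r y
    using that by (auto simp: max_def)
  have p: "c * max (a i) 0 \<le> pmf g (pad i)" "c * max (- a i) 0 \<le> pmf g (ones_minus (pad i))"
    if "i \<in> cube (d - 1)" for i
    using g[OF that] pmf_nonneg[of g "pad i"] pmf_nonneg[of g "ones_minus (pad i)"]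
    by (intro *; linarith)+
  from d True show ?thesis
    by (rule cube_cases) (use p T in \<open>simp_all add: pmf_pad pmf_ones_minus_pad\<close>)
qed (simp add: outside)

end

section \<open>Null and equivalent polynomials\<close>

lemma H_map_eq_iff:
  "H_map d f = (\<Sum>i\<in>cube (d - 1). mterm (b i) i) \<longleftrightarrow>
     (\<forall>i\<in>cube (d - 1). pmf f (pad i) - pmf f (ones_minus (pad i)) = b i)"
  unfolding H_map_def by (rule sum_mterm_eq_iff)

lemma H_map_eq_0_iff:
  "H_map d f = 0 \<longleftrightarrow> (\<forall>i\<in>cube (d - 1). pmf f (pad i) = pmf f (ones_minus (pad i)))"
proof -
  have "(0 :: real mpoly) = (\<Sum>i\<in>cube (d - 1). mterm 0 i)"
    by (simp add: mterm_def)
  then show ?thesis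
    using H_map_eq_iff[of d f "\<lambda>_. 0"] by simp
qed

text \<open>Averaging with the complement replaces a coordinate mean \<open>m\<close> by the average
  of \<open>m\<close> and \<open>1 - m\<close>, hence keeps 1/2, and it preserves the central
  levels. This supplies a null partner when a mixture of weight 1 determines none.\<close>

lemma obtain_symmetrization:
  assumes d: "d \<ge> 1" and f: "f \<in> central_SB d"
  obtains g where "g \<in> central_SB d" "H_map d g = 0"
proof -
  define w where "w = (\<lambda>x. if x \<in> cube d then (pmf f x + pmf f (ones_minus x)) / 2 else 0)"
  have supp: "set_pmf f \<subseteq> cube d"
    and marg: "\<And>j. j < d \<Longrightarrow> (\<Sum>x\<in>cube d. pmf f x * real (x ! j)) = 1 / 2"
    using f by (auto simp: central_SB_def SB_iff)
  have flip: "(\<Sum>x\<in>cube d. h (ones_minus x)) = (\<Sum>x\<in>cube d. h x)" for h :: "_ \<Rightarrow> real"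
    by (rule sum.reindex_bij_betw[OF bij_betw_ones_minus])
  have tot: "(\<Sum>x\<in>cube d. pmf f x) = 1"
    by (rule sum_pmf_eq_1[OF finite_cube supp])
  obtain g where g: "\<And>x. pmf g x = w x"
  proof (rule obtain_pmf[OF finite_cube[of d], of w])
    show "(\<Sum>x\<in>cube d. w x) = 1"
      by (simp add: w_def add_divide_distrib sum.distrib flip[of "pmf f"] tot
          flip: sum_divide_distrib)
  qed (auto simp: w_def)
  have "(\<Sum>x\<in>cube d. w x * real (x ! j)) = 1 / 2" if j: "j < d" for j
  proof -
    have "(\<Sum>x\<in>cube d. pmf f (ones_minus x) * real (x ! j)) =
        (\<Sum>x\<in>cube d. pmf f x * real (ones_minus x ! j))"
      using flip[of "\<lambda>x. pmf f x * real (ones_minus x ! j)"]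
      by (simp add: ones_minus_cube_involutive cong: sum.cong)
    also have "\<dots> = (\<Sum>x\<in>cube d. pmf f x - pmf f x * real (x ! j))"
      using j by (intro sum.cong) (auto simp: nth_ones_minus algebra_simps)
    also have "\<dots> = 1 / 2"
      by (simp add: sum_subtractf tot marg[OF j])
    finally show ?thesis
      using marg[OF j]
      by (simp add: w_def field_simps sum.distrib sum_distrib_left flip: sum_divide_distrib)
  qed
  moreover have "w x = 0" if "x \<notin> central_cube d" for x
    using f that ones_minus_central_cube[of x d] by (auto simp: w_def central_SB_iff)
  ultimately have "g \<in> central_SB d"
    by (simp add: central_SB_iff g)
  moreover have "H_map d g = 0"
    using pad_cube[OF d] ones_minus_cube[OF pad_cube[OF d]]
    by (simp add: H_map_eq_0_iff g w_def ones_minus_cube_involutive[OF pad_cube[OF d]] add.commute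
        del: One_nat_def)
  ultimately show thesis
    by (rule that)
qed

context type0
begin

text \<open>By linearity the null partner contributes nothing, and \<open>f\<close> contributes
  \<open>u\<close> times its own coefficients \<open>a i / T\<close>.\<close>

lemma H_map_mixture:
  assumes "H_map d g = 0"
    and "\<And>x. pmf h x = u * pmf f x + (1 - u) * pmf g x"
  shows "H_map d h = (\<Sum>i\<in>cube (d - 1). mterm (u / T * a i) i)"
proof -
  have "pmf h (pad i) - pmf h (ones_minus (pad i)) = u / T * a i" if "i \<in> cube (d - 1)" for i
  proof -
    have "pmf h (pad i) - pmf h (ones_minus (pad i)) =
        u * (pmf f (pad i) - pmf f (ones_minus (pad i)))"
      using assms that by (simp add: H_map_eq_0_iff right_diff_distrib del: One_nat_def)
    then show ?thesis
      using diff_eq[OF that] by simp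
  qed
  then show ?thesis
    unfolding H_map_eq_iff by blast
qed

text \<open>The coefficients \<open>a i / T\<close> of \<open>f\<close> force the weight
  \<open>c * T\<close>. Summing \<open>scaled_le\<close> over the cube bounds it by 1, and the
  remainder of \<open>h\<close> is the null partner.\<close>

lemma decompose:
  assumes f: "f \<in> central_SB d" and h: "h \<in> central_SB d" and "c > 0"
    and H: "H_map d h = (\<Sum>i\<in>cube (d - 1). mterm (c * a i) i)"
  shows "c * T \<in> {0<..1} \<and> (\<exists>g. g \<in> central_SB d \<and> H_map d g = 0 \<and>
      (\<forall>x. pmf h x = c * T * pmf f x + (1 - c * T) * pmf g x))"
proof -
  have diff: "pmf h (pad i) - pmf h (ones_minus (pad i)) = c * a i" if "i \<in> cube (d - 1)" for i
    using H that by (simp only: H_map_eq_iff)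
  note le = scaled_le[OF diff \<open>c > 0\<close>]
  have tot: "(\<Sum>x\<in>cube d. pmf g x) = 1" if "g \<in> central_SB d" for g
    using that by (intro sum_pmf_eq_1 finite_cube) (auto simp: central_SB_def SB_iff)
  have "(\<Sum>x\<in>cube d. c * T * pmf f x) \<le> (\<Sum>x\<in>cube d. pmf h x)"
    by (rule sum_mono) (rule le)
  then have le1: "c * T \<le> 1"
    by (simp add: tot[OF f] tot[OF h] flip: sum_distrib_left)
  moreover have pos: "c * T > 0"
    using \<open>c > 0\<close> T by simp
  moreover have "\<exists>g. g \<in> central_SB d \<and> H_map d g = 0 \<and>
      (\<forall>x. pmf h x = c * T * pmf f x + (1 - c * T) * pmf g x)"
  proof (cases "c * T = 1")
    case True
    have "pmf h x = pmf f x" for x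
    proof (cases "x \<in> cube d")
      case True
      \<comment> \<open>The differences are nonnegative and sum to 0, both pmfs having total mass
        1.\<close>
      have "\<forall>x\<in>cube d. pmf h x - pmf f x = 0"
        using le \<open>c * T = 1\<close>
        by (subst sum_nonneg_eq_0_iff[symmetric])
          (auto simp: finite_cube sum_subtractf tot[OF f] tot[OF h])
      with True show ?thesis by simp
    next
      case False
      with h show ?thesis
        by (auto simp: central_SB_iff central_cube_def outside)
    qed
    with True obtain_symmetrization[OF d f] show ?thesis
      by (metis add.right_neutral diff_self mult_1 mult_zero_left)
  next
    case False
    with le1 have "c * T < 1" by simp
    from central_SB_remainder[OF f h this le] obtain g where g: "g \<in> central_SB d"
      and hg: "\<And>x. pmf h x = c * T * pmf f x + (1 - c * T) * pmf g x"
      by blast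
    have "pmf g (pad i) = pmf g (ones_minus (pad i))" if i: "i \<in> cube (d - 1)" for i
    proof -
      \<comment> \<open>The first summand is already \<open>c * a i\<close>, so the second vanishes,
        and its factor \<open>1 - c * T\<close> is nonzero.\<close>
      have "c * a i = c * T * (a i / T) + (1 - c * T) * (pmf g (pad i) - pmf g (ones_minus (pad i)))"
        using diff[OF i] diff_eq[OF i] by (simp add: hg algebra_simps)
      then show ?thesis
        using T False by simp
    qed
    then have "H_map d g = 0"
      by (simp add: H_map_eq_0_iff)
    with g hg show ?thesis by blast
  qed
  ultimately show ?thesis by simp
qed

end

text \<open>Pmfs are real valued and \<open>P\<close> is rational, so the scalars may be read in
  either field. Weight and factor are linked by \<open>lam = \<mu> * T\<close> with the rational
  total weight \<open>T\<close>, so one is rational exactly when the other is.\<close>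

theorem proposition3p3:
  fixes d :: nat and P :: "rat mpoly" and a :: "nat list \<Rightarrow> rat"
  assumes d: "d \<ge> 2"
    and P_ideal: "P \<in> ideal_IP d"
    and P_coeffs: "P = (\<Sum>i\<in>cube (d - 1). mterm (a i) i)"
    and P_nonnull: "P \<noteq> 0"
    and central: "\<forall>i\<in>cube (d - 1). i \<notin> central_indices d \<longrightarrow> a i = 0"
    and same_order: "\<forall>k. (\<Sum>i | i \<in> cube (d - 1) \<and> sum_list i = k. a i) = 0"
    and containing: "\<forall>j<d - 1. (\<Sum>i | i \<in> cube (d - 1) \<and> i ! j = 1. a i) = 0"
  shows "sum_cx_smallest d (type0_pmf d P) \<and>
    \<comment> \<open>scalars \<open>lam\<close>, \<open>\<mu>\<close> in the rationals\<close>
    {f. \<exists>lam\<in>{0<..1} \<inter> \<rat>. \<exists>fK. sum_cx_smallest d fK \<and> H_map d fK = 0 \<and>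
          (\<forall>x. pmf f x = lam * pmf (type0_pmf d P) x + (1 - lam) * pmf fK x)}
      = {f. sum_cx_smallest d f \<and>
          (\<exists>Q\<in>ideal_IP d. poly_equivalent Q P \<and> H_map d f = to_real_poly Q)} \<and>
    \<comment> \<open>scalars \<open>lam\<close>, \<open>\<mu>\<close> in the reals\<close>
    {f. \<exists>lam\<in>{0<..1}. \<exists>fK. sum_cx_smallest d fK \<and> H_map d fK = 0 \<and>
          (\<forall>x. pmf f x = lam * pmf (type0_pmf d P) x + (1 - lam) * pmf fK x)}
      = {f. sum_cx_smallest d f \<and> poly_equivalent (H_map d f) (to_real_poly P)}"
proof -
  have d1: "d \<ge> 1" using d by simp
  define f where "f = type0_pmf d P"
  define T where "T = (\<Sum>y\<in>cube d. type0_weight P y)"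
  define \<alpha> where "\<alpha> = (\<lambda>i. real_of_rat (a i))"
  have coeff: "mcoeff P i = a i" if "i \<in> cube (d - 1)" for i
    using mcoeff_sum_mterm[OF that] by (simp add: P_coeffs)
  obtain i0 where i0: "i0 \<in> cube (d - 1)" "a i0 \<noteq> 0"
    using P_nonnull unfolding P_coeffs mterm_def by (force intro: sum.neutral)
  have pmf_f: "pmf f x = (if x \<in> cube d then of_rat (type0_weight P x) / of_rat T else 0)" for x
    unfolding f_def T_def using pmf_type0[OF d1 i0(1)] i0 coeff by (simp add: of_rat_divide)
  have "T > 0"
  proof -
    \<comment> \<open>Division by 0 yields 0, so otherwise all masses of \<open>f\<close> would
      vanish.\<close>
    have "T \<noteq> 0"
      using pmf_f sum_pmf_eq_1[OF finite_cube, of f d]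
      by (metis (no_types, lifting) div_by_0 of_rat_0 set_pmf_iff subsetI sum.neutral zero_neq_one)
    then show ?thesis
      using sum_nonneg[of "cube d" "type0_weight P"] type0_weight_nonneg
      by (simp add: T_def order_less_le)
  qed
  then interpret type0 d \<alpha> "of_rat T" f
    using d1 pad_cube[OF d1] ones_minus_cube[OF pad_cube[OF d1]]
    by unfold_locales
      (auto simp: pmf_f \<alpha>_def type0_weight_pad type0_weight_ones_minus_pad coeff max_def
        of_rat_minus)

  \<comment> \<open>Condition (2), summed over all orders that occur.\<close>
  have total0: "(\<Sum>i\<in>cube (d - 1). a i) = 0"
    using same_order sum.group[where g = sum_list and h = a and S = "cube (d - 1)"
        and T = "sum_list ` cube (d - 1)"] finite_cube
    by simp
  \<comment> \<open>Exponents are 0 or 1, so weighting by \<open>i ! j\<close> selects the monomials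
    of condition (3).\<close>
  have cont0: "(\<Sum>i\<in>cube (d - 1). a i * of_nat (i ! j)) = 0" if j: "j < d - 1" for j
  proof -
    have "(\<Sum>i\<in>cube (d - 1). a i * of_nat (i ! j)) =
        (\<Sum>i\<in>cube (d - 1). if i ! j = 1 then a i else 0)"
      using cubeD(2)[OF _ j] by (intro sum.cong) fastforce+
    also have "\<dots> = (\<Sum>i | i \<in> cube (d - 1) \<and> i ! j = 1. a i)"
      by (rule sum.inter_filter[symmetric, OF finite_cube])
    finally show ?thesis
      using containing j by simp
  qed
  have f_central: "f \<in> central_SB d"
    unfolding central_SB_iff
  proof (intro conjI allI impI)
    show "pmf f x = 0" if "x \<notin> central_cube d" for x
    proof (rule supported_central[OF _ that])
      show "\<alpha> i = 0" if "i \<in> cube (d - 1)" "i \<notin> central_indices d" for i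
        using central that by (simp add: \<alpha>_def)
    qed
    show "(\<Sum>x\<in>cube d. pmf f x * real (x ! j)) = 1 / 2" if "j < d" for j
    proof (rule marginal[OF _ _ that])
      show "(\<Sum>i\<in>cube (d - 1). \<alpha> i) = 0"
        using arg_cong[OF total0, of real_of_rat] by (simp add: \<alpha>_def of_rat_sum)
      show "(\<Sum>i\<in>cube (d - 1). \<alpha> i * real (i ! j)) = 0" if "j < d - 1" for j
        using arg_cong[OF cont0[OF that], of real_of_rat]
        by (simp add: \<alpha>_def of_rat_sum of_rat_mult)
    qed
  qed
  \<comment> \<open>\<open>f\<close> itself is the central member needed to exclude all non-central
    pmfs.\<close>
  have smallest_iff: "sum_cx_smallest d h \<longleftrightarrow> h \<in> central_SB d" for h
    using central_SB_smallest sum_cx_smallest_central[OF f_central] by blast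
  have scaled: "mscale c (to_real_poly P) = (\<Sum>i\<in>cube (d - 1). mterm (c * \<alpha> i) i)" for c
    by (simp add: P_coeffs to_real_poly_sum_mterm mscale_sum_mterm \<alpha>_def)
  have rat_scaled: "to_real_poly (mscale c P) = mscale (of_rat c) (to_real_poly P)" for c
    by (simp add: P_coeffs to_real_poly_sum_mterm mscale_sum_mterm of_rat_mult)

  have mixture: "h \<in> central_SB d \<and> H_map d h = mscale (lam / of_rat T) (to_real_poly P)"
    if "g \<in> central_SB d" "H_map d g = 0"
      "\<forall>x. pmf h x = lam * pmf f x + (1 - lam) * pmf g x" for g h lam
    using central_SB_mixture[OF f_central that(1)] H_map_mixture[OF that(2)] that(3)
    by (simp add: scaled)
  note decomp = decompose[OF f_central, unfolded scaled[symmetric]]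

  have "{h. \<exists>lam\<in>{0<..1}. \<exists>g. sum_cx_smallest d g \<and> H_map d g = 0 \<and>
          (\<forall>x. pmf h x = lam * pmf f x + (1 - lam) * pmf g x)}
      = {h. sum_cx_smallest d h \<and> poly_equivalent (H_map d h) (to_real_poly P)}" (is "?L = ?R")
  proof (intro equalityI subsetI)
    fix h assume "h \<in> ?L"
    then obtain lam g where "lam \<in> {0<..1}" "g \<in> central_SB d" "H_map d g = 0"
      "\<forall>x. pmf h x = lam * pmf f x + (1 - lam) * pmf g x"
      by (auto simp: smallest_iff)
    with mixture[of g h lam] T show "h \<in> ?R"
      by (auto simp: smallest_iff poly_equivalent_def intro!: exI[of _ "lam / of_rat T"])
  next
    fix h assume "h \<in> ?R"
    then obtain \<mu> where "h \<in> central_SB d" "\<mu> > 0" "H_map d h = mscale \<mu> (to_real_poly P)"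
      by (auto simp: smallest_iff poly_equivalent_def)
    from decomp[OF this] show "h \<in> ?L"
      unfolding smallest_iff by blast
  qed
  moreover have "{h. \<exists>lam\<in>{0<..1} \<inter> \<rat>. \<exists>g. sum_cx_smallest d g \<and> H_map d g = 0 \<and>
          (\<forall>x. pmf h x = lam * pmf f x + (1 - lam) * pmf g x)}
      = {h. sum_cx_smallest d h \<and>
          (\<exists>Q\<in>ideal_IP d. poly_equivalent Q P \<and> H_map d h = to_real_poly Q)}" (is "?L = ?R")
  proof (intro equalityI subsetI)
    fix h assume "h \<in> ?L"
    then obtain lam g where lam: "lam \<in> {0<..1}" "lam \<in> \<rat>" and g: "g \<in> central_SB d"
      "H_map d g = 0" "\<forall>x. pmf h x = lam * pmf f x + (1 - lam) * pmf g x"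
      by (auto simp: smallest_iff)
    from lam obtain r where r: "lam = of_rat r" "r > 0"
      by (auto elim: Rats_cases)
    \<comment> \<open>The witness for \<open>Q\<close>: the factor \<open>r / T\<close> is rational
      and positive because both \<open>r\<close> and \<open>T\<close> are.\<close>
    have "mscale (r / T) P \<in> ideal_IP d" "poly_equivalent (mscale (r / T) P) P"
      using r(2) \<open>T > 0\<close> P_ideal
      by (auto intro!: mscale_ideal_IP simp: poly_equivalent_def intro: divide_pos_pos)
    moreover have "h \<in> central_SB d" "H_map d h = to_real_poly (mscale (r / T) P)"
      using mixture[OF g] by (simp_all add: rat_scaled r(1) of_rat_divide)
    ultimately show "h \<in> ?R"
      by (auto simp: smallest_iff)
  next
    fix h assume "h \<in> ?R"
    then obtain \<mu> where "h \<in> central_SB d" and \<mu>: "\<mu> > 0"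
      "H_map d h = to_real_poly (mscale \<mu> P)"
      by (auto simp: smallest_iff poly_equivalent_def)
    then have "of_rat \<mu> * of_rat T \<in> {0<..1::real} \<and> (\<exists>g. g \<in> central_SB d \<and> H_map d g = 0 \<and>
      (\<forall>x. pmf h x = of_rat \<mu> * of_rat T * pmf f x + (1 - of_rat \<mu> * of_rat T) * pmf g x))"
      by (intro decomp) (simp_all add: rat_scaled)
    moreover have "of_rat \<mu> * of_rat T \<in> (\<rat> :: real set)"
      by simp
    ultimately show "h \<in> ?L"
      unfolding smallest_iff by blast
  qed
  ultimately show ?thesis
    using smallest_iff f_central by (simp add: f_def)
qed

end
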